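(* For the uplink pinching-antenna system with $N$ pinching antennas and fixed minimum spacing $\Delta$, $$\lim_{N\to\infty}\mathcal R_{\mathrm M,\mathrm T}^{\mathrm U}=\lim_{N\to\infty}\mathcal R_{\mathrm M,\mathrm F}^{\mathrm U}=\lim_{N\to\infty}\mathcal C_{\mathrm M}^{\mathrm U}=\{(0,0)\}.$$
   Context: Setting. For fixed $\eta,\sigma^2,d,k_0,\lambda_{\mathrm g},\Delta,P_1,P_2>0$, $y_{\mathrm p},q_0\in\mathbb R$ and fixed users at $[x_k,y_k,0]^{\mathsf T}$, $k=1,2$, put $d_k^2=d^2+(y_k-y_{\mathrm p})^2$. For each integer $N>1$ the feasible set is $\mathcal P=\{\mathbf q=(q_1,\dots,q_N)\in\mathbb R^N:|q_n-q_{n'}|\ge\Delta\ \forall n\ne n'\}$. The effective channel of user $k$ is $$h_k(\mathbf q)=\frac1{\sqrt N}\sum_{n=1}^N\frac{\sqrt\eta\,e^{-\mathrm jk_0\sqrt{d_k^2+(x_k-q_n)^2}}}{\sqrt{d_k^2+(x_k-q_n)^2}}\,e^{-\mathrm j2\pi|q_n-q_0|/\lambda_{\mathrm g}}.$$ Let $\mathrm{Conv}$ denote the convex hull. Capacity region: $\mathcal C_{\mathrm M}^{\mathrm U}=\mathrm{Conv}(\bigcup_{\mathbf q\in\mathcal P}\mathcal C^{\mathrm U}(\mathbf q))$, where $\mathcal C^{\mathrm U}(\mathbf q)$ is the set of $(R_1,R_2)$ with $0\le R_k\le\log_2(1+P_k|h_k(\mathbf q)|^2/\sigma^2)$, $k=1,2$,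 and $R_1+R_2\le\log_2(1+(P_1|h_1(\mathbf q)|^2+P_2|h_2(\mathbf q)|^2)/\sigma^2)$. TDMA region: $\mathcal R_{\mathrm M,\mathrm T}^{\mathrm U}=\bigcup_{\rho\in[0,1]}\{(R_1,R_2):0\le R_1\le\rho\,\bar r_1,\ 0\le R_2\le(1-\rho)\,\bar r_2\}$, where $\bar r_k=\sup_{\mathbf q\in\mathcal P}\log_2(1+P_k|h_k(\mathbf q)|^2/\sigma^2)$. FDMA region: $\mathcal R_{\mathrm M,\mathrm F}^{\mathrm U}=\mathrm{Conv}(\bigcup_{\mathbf q\in\mathcal P}\bigcup_{\rho\in[0,1]}\{(R_1,R_2):0\le R_k\le R_k^\rho(\mathbf q),\ k=1,2\})$ with $R_1^\rho(\mathbf q)=\rho\log_2(1+\frac{P_1|h_1(\mathbf q)|^2}{\rho\sigma^2})$, $R_2^\rho(\mathbf q)=(1-\rho)\log_2(1+\frac{P_2|h_2(\mathbf q)|^2}{(1-\rho)\sigma^2})$, $R_1^0\equiv0$, $R_2^1\equiv0$. All these regions depend on $N$. The statement $\lim_{N\to\infty}\mathcal A_N=\{(0,0)\}$ for regions $\mathcal A_N\subseteq[0,\infty)^2$ containing $(0,0)$ means: for every $\varepsilon>0$ there is $N_0$ such that $\mathcal A_N\subseteq[0,\varepsilon]^2$ for all $N\ge N_0$. *)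

theory Defs
  imports "HOL-Analysis.Analysis"
begin

text \<open>An antenna placement in \<open>\<real>\<^sup>N\<close> is a function on the index set \<open>{1..N}\<close> (extensional
  outside it), since \<open>N\<close> varies in the asymptotic statement.\<close>

definition feasible_set :: "real \<Rightarrow> nat \<Rightarrow> (nat \<Rightarrow> real) set" where
  "feasible_set \<Delta> N =
     {q \<in> {1..N} \<rightarrow>\<^sub>E UNIV. \<forall>n\<in>{1..N}. \<forall>n'\<in>{1..N}. n \<noteq> n' \<longrightarrow> \<bar>q n - q n'\<bar> \<ge> \<Delta>}"

text \<open>Distance between a user at \<open>(xk, yk, 0)\<close> and an antenna at position \<open>t\<close> along a waveguide
  of height \<open>d\<close> and lateral offset \<open>yp\<close>; the first two summands are \<open>d\<^sub>k\<^sup>2\<close>.\<close>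

definition user_distance :: "real \<Rightarrow> real \<Rightarrow> real \<Rightarrow> real \<Rightarrow> real \<Rightarrow> real" where
  "user_distance d yp xk yk t = sqrt ((d\<^sup>2 + (yk - yp)\<^sup>2) + (xk - t)\<^sup>2)"

definition effective_channel ::
  "real \<Rightarrow> real \<Rightarrow> real \<Rightarrow> real \<Rightarrow> real \<Rightarrow> real \<Rightarrow> real \<Rightarrow> real \<Rightarrow> nat \<Rightarrow> (nat \<Rightarrow> real) \<Rightarrow> complex" where
  "effective_channel \<eta> d k0 lambda_g yp q0 xk yk N q =
     1 / complex_of_real (sqrt (real N)) *
     (\<Sum>n = 1..N.
        complex_of_real (sqrt \<eta>) *
        exp (- \<i> * complex_of_real (k0 * user_distance d yp xk yk (q n))) /
        complex_of_real (user_distance d yp xk yk (q n)) *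
        exp (- \<i> * complex_of_real (2 * pi * \<bar>q n - q0\<bar> / lambda_g)))"

text \<open>The regions take the two channels as functions \<open>h1\<close>, \<open>h2\<close> of the placement;
  \<open>\<sigma>2\<close> is the noise power \<open>\<sigma>\<^sup>2\<close>.\<close>

definition single_user_rate :: "real \<Rightarrow> real \<Rightarrow> complex \<Rightarrow> real" where
  "single_user_rate \<sigma>2 P h = log 2 (1 + P * (cmod h)\<^sup>2 / \<sigma>2)"

definition mac_region :: "real \<Rightarrow> real \<Rightarrow> real \<Rightarrow> complex \<Rightarrow> complex \<Rightarrow> (real \<times> real) set" where
  "mac_region \<sigma>2 P1 P2 h1 h2 =
     {(R1, R2). 0 \<le> R1 \<and> R1 \<le> single_user_rate \<sigma>2 P1 h1 \<and>
                0 \<le> R2 \<and> R2 \<le> single_user_rate \<sigma>2 P2 h2 \<and>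
                R1 + R2 \<le> log 2 (1 + (P1 * (cmod h1)\<^sup>2 + P2 * (cmod h2)\<^sup>2) / \<sigma>2)}"

definition capacity_region ::
  "real \<Rightarrow> real \<Rightarrow> real \<Rightarrow> real \<Rightarrow> ((nat \<Rightarrow> real) \<Rightarrow> complex) \<Rightarrow> ((nat \<Rightarrow> real) \<Rightarrow> complex) \<Rightarrow> nat
     \<Rightarrow> (real \<times> real) set" where
  "capacity_region \<Delta> \<sigma>2 P1 P2 h1 h2 N =
     convex hull (\<Union>q\<in>feasible_set \<Delta> N. mac_region \<sigma>2 P1 P2 (h1 q) (h2 q))"

definition max_rate :: "real \<Rightarrow> real \<Rightarrow> real \<Rightarrow> ((nat \<Rightarrow> real) \<Rightarrow> complex) \<Rightarrow> nat \<Rightarrow> real" where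
  "max_rate \<Delta> \<sigma>2 P h N = (SUP q\<in>feasible_set \<Delta> N. single_user_rate \<sigma>2 P (h q))"

definition tdma_region ::
  "real \<Rightarrow> real \<Rightarrow> real \<Rightarrow> real \<Rightarrow> ((nat \<Rightarrow> real) \<Rightarrow> complex) \<Rightarrow> ((nat \<Rightarrow> real) \<Rightarrow> complex) \<Rightarrow> nat
     \<Rightarrow> (real \<times> real) set" where
  "tdma_region \<Delta> \<sigma>2 P1 P2 h1 h2 N =
     (\<Union>\<rho>\<in>{0..1}. {(R1, R2). 0 \<le> R1 \<and> R1 \<le> \<rho> * max_rate \<Delta> \<sigma>2 P1 h1 N \<and>
                             0 \<le> R2 \<and> R2 \<le> (1 - \<rho>) * max_rate \<Delta> \<sigma>2 P2 h2 N})"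

text \<open>Rate of a user given the fraction \<open>b\<close> of the bandwidth: \<open>b = \<rho>\<close> for user 1 and
  \<open>b = 1 - \<rho>\<close> for user 2.\<close>

definition fdma_rate :: "real \<Rightarrow> real \<Rightarrow> real \<Rightarrow> complex \<Rightarrow> real" where
  "fdma_rate b \<sigma>2 P h = (if b = 0 then 0 else b * log 2 (1 + P * (cmod h)\<^sup>2 / (b * \<sigma>2)))"

definition fdma_region ::
  "real \<Rightarrow> real \<Rightarrow> real \<Rightarrow> real \<Rightarrow> ((nat \<Rightarrow> real) \<Rightarrow> complex) \<Rightarrow> ((nat \<Rightarrow> real) \<Rightarrow> complex) \<Rightarrow> nat
     \<Rightarrow> (real \<times> real) set" where
  "fdma_region \<Delta> \<sigma>2 P1 P2 h1 h2 N =
     convex hull (\<Union>q\<in>feasible_set \<Delta> N. \<Union>\<rho>\<in>{0..1}.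
       {(R1, R2). 0 \<le> R1 \<and> R1 \<le> fdma_rate \<rho> \<sigma>2 P1 (h1 q) \<and>
                  0 \<le> R2 \<and> R2 \<le> fdma_rate (1 - \<rho>) \<sigma>2 P2 (h2 q)})"

text \<open>The limit \<open>{(0,0)}\<close> of regions lying in the nonnegative quadrant and containing the
  origin. That the three regions are of this kind is shown below.\<close>

definition regions_tend_to_origin :: "(nat \<Rightarrow> (real \<times> real) set) \<Rightarrow> bool" where
  "regions_tend_to_origin A \<longleftrightarrow>
     (\<forall>\<epsilon>>0. \<exists>N0. \<forall>N\<ge>N0. A N \<subseteq> {0..\<epsilon>} \<times> {0..\<epsilon>})"

lemma feasible_set_nonempty:
  assumes "\<Delta> > 0"
  shows "feasible_set \<Delta> N \<noteq> {}"
proof -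
  have "\<bar>real n * \<Delta> - real m * \<Delta>\<bar> \<ge> \<Delta>" if "n \<noteq> m" for n m :: nat
  proof -
    have "\<bar>real n - real m\<bar> \<ge> 1" using that by linarith
    then have "1 * \<Delta> \<le> \<bar>real n - real m\<bar> * \<Delta>"
      using assms by (intro mult_right_mono) auto
    moreover have "\<bar>real n * \<Delta> - real m * \<Delta>\<bar> = \<bar>real n - real m\<bar> * \<Delta>"
      using assms by (simp add: abs_mult flip: left_diff_distrib)
    ultimately show ?thesis by simp
  qed
  then have "restrict (\<lambda>n. real n * \<Delta>) {1..N} \<in> feasible_set \<Delta> N"
    by (auto simp: feasible_set_def)
  then show ?thesis by blast
qed

lemma log2_one_plus_nonneg: "0 \<le> log 2 (1 + t)" if "0 \<le> t" for t :: real
  using that by (subst zero_le_log_cancel_iff) auto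

lemma single_user_rate_nonneg:
  assumes "\<sigma>2 > 0" "P > 0"
  shows "0 \<le> single_user_rate \<sigma>2 P h"
  unfolding single_user_rate_def using assms by (intro log2_one_plus_nonneg) simp

lemma fdma_rate_nonneg:
  assumes "\<sigma>2 > 0" "P > 0" "0 \<le> b"
  shows "0 \<le> fdma_rate b \<sigma>2 P h"
  using assms by (simp add: fdma_rate_def log2_one_plus_nonneg)

lemma effective_channel_bounded:
  assumes "\<eta> > 0" "d > 0"
  shows "cmod (effective_channel \<eta> d k0 lambda_g yp q0 xk yk N q)
           \<le> 1 / sqrt (real N) * (real N * (sqrt \<eta> / d))"
proof -
  have dist: "d \<le> user_distance d yp xk yk t" for t
    using assms unfolding user_distance_def by (intro real_le_rsqrt) simp
  have "cmod (complex_of_real (sqrt \<eta>) *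
        exp (- \<i> * complex_of_real (k0 * user_distance d yp xk yk (q n))) /
        complex_of_real (user_distance d yp xk yk (q n)) *
        exp (- \<i> * complex_of_real (2 * pi * \<bar>q n - q0\<bar> / lambda_g))) \<le> sqrt \<eta> / d" for n
    using dist[of "q n"] assms
    by (simp add: norm_mult norm_divide norm_exp_eq_Re frac_le)
  then have "cmod (\<Sum>n = 1..N. complex_of_real (sqrt \<eta>) *
        exp (- \<i> * complex_of_real (k0 * user_distance d yp xk yk (q n))) /
        complex_of_real (user_distance d yp xk yk (q n)) *
        exp (- \<i> * complex_of_real (2 * pi * \<bar>q n - q0\<bar> / lambda_g))) \<le> real N * (sqrt \<eta> / d)"
    by (intro order.trans[OF sum_norm_bound[where K = "sqrt \<eta> / d"]]) simp_all
  then show ?thesis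
    unfolding effective_channel_def norm_mult
    by (intro mult_mono) (simp_all add: norm_divide)
qed

text \<open>The supremum in \<^const>\<open>max_rate\<close> is taken over a nonempty bounded set.\<close>

lemma bdd_above_single_user_rate:
  assumes "\<eta> > 0" "d > 0" "\<sigma>2 > 0" "P > 0"
  shows "bdd_above ((\<lambda>q. single_user_rate \<sigma>2 P (effective_channel \<eta> d k0 lambda_g yp q0 xk yk N q)) ` S)"
proof -
  define B where "B = 1 / sqrt (real N) * (real N * (sqrt \<eta> / d))"
  have "single_user_rate \<sigma>2 P (effective_channel \<eta> d k0 lambda_g yp q0 xk yk N q)
          \<le> log 2 (1 + P * B\<^sup>2 / \<sigma>2)" for q
  proof -
    let ?h = "effective_channel \<eta> d k0 lambda_g yp q0 xk yk N q"
    have "(cmod ?h)\<^sup>2 \<le> B\<^sup>2"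
      using effective_channel_bounded[OF assms(1,2)] by (simp add: B_def power_mono)
    then have "P * (cmod ?h)\<^sup>2 / \<sigma>2 \<le> P * B\<^sup>2 / \<sigma>2"
      using assms by (simp add: divide_right_mono)
    moreover have "0 \<le> P * (cmod ?h)\<^sup>2 / \<sigma>2" using assms by simp
    ultimately show ?thesis
      by (simp add: single_user_rate_def)
  qed
  then show ?thesis by (intro bdd_aboveI2)
qed

lemma max_rate_nonneg:
  assumes "\<Delta> > 0" "\<eta> > 0" "d > 0" "\<sigma>2 > 0" "P > 0"
  shows "0 \<le> max_rate \<Delta> \<sigma>2 P (effective_channel \<eta> d k0 lambda_g yp q0 xk yk N) N"
proof -
  obtain q where "q \<in> feasible_set \<Delta> N" using feasible_set_nonempty[OF assms(1)] by blast
  then show ?thesis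
    unfolding max_rate_def
    by (rule cSUP_upper2[OF bdd_above_single_user_rate[OF assms(2-)]])
       (rule single_user_rate_nonneg[OF assms(4,5)])
qed

lemma origin_in_regions:
  fixes k0 lambda_g yp q0 x1 y1 x2 y2 :: real
  assumes "\<Delta> > 0" "\<eta> > 0" "d > 0" "\<sigma>2 > 0" "P1 > 0" "P2 > 0"
  defines "h1 \<equiv> effective_channel \<eta> d k0 lambda_g yp q0 x1 y1"
      and "h2 \<equiv> effective_channel \<eta> d k0 lambda_g yp q0 x2 y2"
  shows "(0, 0) \<in> tdma_region \<Delta> \<sigma>2 P1 P2 (h1 N) (h2 N) N"
    and "(0, 0) \<in> fdma_region \<Delta> \<sigma>2 P1 P2 (h1 N) (h2 N) N"
    and "(0, 0) \<in> capacity_region \<Delta> \<sigma>2 P1 P2 (h1 N) (h2 N) N"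
proof -
  obtain q where q: "q \<in> feasible_set \<Delta> N" using feasible_set_nonempty[OF assms(1)] by blast
  show "(0, 0) \<in> tdma_region \<Delta> \<sigma>2 P1 P2 (h1 N) (h2 N) N"
    using max_rate_nonneg[OF assms(1-4,6)]
    unfolding tdma_region_def h1_def h2_def by (auto intro!: bexI[of _ 0])
  show "(0, 0) \<in> fdma_region \<Delta> \<sigma>2 P1 P2 (h1 N) (h2 N) N"
    using q assms(4-6) unfolding fdma_region_def
    by (intro hull_inc) (auto intro!: bexI[of _ q] bexI[of _ 0] fdma_rate_nonneg)
  show "(0, 0) \<in> capacity_region \<Delta> \<sigma>2 P1 P2 (h1 N) (h2 N) N"
    using q assms(4-6) unfolding capacity_region_def
    by (intro hull_inc) (auto simp: mac_region_def intro!: bexI[of _ q] single_user_rate_nonneg log2_one_plus_nonneg)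
qed

lemma regions_nonneg:
  shows "tdma_region \<Delta> \<sigma>2 P1 P2 h1 h2 N \<subseteq> {0..} \<times> {0..}"
    and "fdma_region \<Delta> \<sigma>2 P1 P2 h1 h2 N \<subseteq> {0..} \<times> {0..}"
    and "capacity_region \<Delta> \<sigma>2 P1 P2 h1 h2 N \<subseteq> {0..} \<times> {0..}"
proof -
  have conv: "convex ({0..} \<times> {0..} :: (real \<times> real) set)"
    by (intro convex_Times convex_real_interval)
  show "tdma_region \<Delta> \<sigma>2 P1 P2 h1 h2 N \<subseteq> {0..} \<times> {0..}"
    by (auto simp: tdma_region_def)
  show "fdma_region \<Delta> \<sigma>2 P1 P2 h1 h2 N \<subseteq> {0..} \<times> {0..}"
    unfolding fdma_region_def by (rule hull_minimal[of _ "{0..} \<times> {0..}" convex, OF _ conv]) auto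
  show "capacity_region \<Delta> \<sigma>2 P1 P2 h1 h2 N \<subseteq> {0..} \<times> {0..}"
    unfolding capacity_region_def by (rule hull_minimal[of _ "{0..} \<times> {0..}" convex, OF _ conv]) (auto simp: mac_region_def)
qed

end

theory Submission
  imports Defs "HOL-Real_Asymp.Real_Asymp"
begin

text \<open>Sorting the antennas into buckets of length \<open>\<Delta>\<close> counted from the user puts at most one antenna
  into each bucket, so the amplitudes are dominated by a two-sided harmonic series and add up to
  \<open>O(ln N)\<close>, which the normalisation \<open>1 / sqrt N\<close> sends to \<open>0\<close> uniformly over the placements.
  By \<open>ln (1 + t) \<le> t\<close> all the rates are at most proportional to the channel gain, so the regions
  lie in boxes that shrink to the origin; the boxes being convex, so do the convex hulls.\<close>

section \<open>Harmonic sums over sets of integers\<close>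

text \<open>The nonnegative and the nonpositive integers each contribute \<open>harm N\<close>. Only
  an upper bound results, since 0 is counted on both sides.\<close>

lemma harm_int_interval:
  "(\<Sum>k\<in>{- int N<..<int N}. 1 / (\<bar>real_of_int k\<bar> + 1)) \<le> 2 * harm N"
proof -
  have eq: "(\<Sum>j<N. 1 / (real j + 1)) = harm N"
    unfolding harm_altdef by (simp add: inverse_eq_divide add.commute)
  have "{- int N<..<int N} \<subseteq> int ` {..<N} \<union> (\<lambda>j. - int j) ` {..<N}"
  proof
    fix k assume "k \<in> {- int N<..<int N}"
    then show "k \<in> int ` {..<N} \<union> (\<lambda>j. - int j) ` {..<N}"
      by (cases "k \<ge> 0") (auto simp: image_iff intro!: bexI[of _ "nat \<bar>k\<bar>"])
  qed
  then have "(\<Sum>k\<in>{- int N<..<int N}. 1 / (\<bar>real_of_int k\<bar> + 1))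
      \<le> (\<Sum>k\<in>int ` {..<N} \<union> (\<lambda>j. - int j) ` {..<N}. 1 / (\<bar>real_of_int k\<bar> + 1))"
    by (intro sum_mono2) auto
  also have "\<dots> \<le> (\<Sum>k\<in>int ` {..<N}. 1 / (\<bar>real_of_int k\<bar> + 1))
      + (\<Sum>k\<in>(\<lambda>j. - int j) ` {..<N}. 1 / (\<bar>real_of_int k\<bar> + 1))"
    by (subst sum_Un) (auto intro: sum_nonneg)
  also have "\<dots> = 2 * harm N"
    by (simp add: sum.reindex inj_on_def eq)
  finally show ?thesis .
qed

text \<open>No rearrangement towards 0 is needed: elements of \<open>K\<close> in \<open>?I\<close>
  are covered by the full interval, and the at most \<open>N\<close> others have absolute value at
  least \<open>N\<close>, so together they add at most N / (N + 1).\<close>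

lemma sum_inverse_int_set_le:
  assumes "finite K" and "card K = N"
  shows "(\<Sum>k\<in>K. 1 / (\<bar>real_of_int k\<bar> + 1)) \<le> 2 * harm N + 1"
proof -
  let ?f = "\<lambda>k. 1 / (\<bar>real_of_int k\<bar> + 1)" and ?I = "{- int N<..<int N}"
  have "sum ?f (K - ?I) \<le> (\<Sum>k\<in>K - ?I. 1 / (real N + 1))"
    by (intro sum_mono divide_left_mono) auto
  also have "\<dots> \<le> (\<Sum>k\<in>K. 1 / (real N + 1))"
    using assms(1) by (intro sum_mono2) auto
  also have "\<dots> \<le> 1"
    using assms(2) by simp
  finally have out: "sum ?f (K - ?I) \<le> 1" .
  have "sum ?f (K \<inter> ?I) \<le> sum ?f ?I"
    by (intro sum_mono2) auto
  then show ?thesis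
    using out harm_int_interval[of N] sum.Int_Diff[OF assms(1), of ?f ?I] by linarith
qed

section \<open>Channel bound uniform over placements\<close>

text \<open>Here the minimum spacing enters: two antennas in one half-open bucket of length \<Delta>
  would be closer than \<Delta>.\<close>

lemma inj_on_bucket:
  assumes "\<Delta> > 0" and "q \<in> feasible_set \<Delta> N"
  shows "inj_on (\<lambda>n. \<lfloor>(q n - x) / \<Delta>\<rfloor>) {1..N}"
proof (rule inj_onI, rule ccontr)
  fix n m
  assume nm: "n \<in> {1..N}" "m \<in> {1..N}" "n \<noteq> m"
    and eq: "\<lfloor>(q n - x) / \<Delta>\<rfloor> = \<lfloor>(q m - x) / \<Delta>\<rfloor>"
  have "\<bar>(q n - x) / \<Delta> - (q m - x) / \<Delta>\<bar> < 1"
    using eq by linarith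
  also have "(q n - x) / \<Delta> - (q m - x) / \<Delta> = (q n - q m) / \<Delta>"
    by (simp add: diff_divide_distrib)
  finally have "\<bar>q n - q m\<bar> < \<Delta>"
    using assms(1) by (simp add: abs_divide)
  then show False
    using assms(2) nm by (force simp: feasible_set_def)
qed

text \<open>The distance dominates both the horizontal offset, which controls the bucket index up to
  rounding, and \<open>d\<close>, which absorbs the additive constants. These give the two terms of
  \<open>1 / \<Delta> + 2 / d\<close>.\<close>

lemma inverse_user_distance_le:
  assumes "d > 0" and "\<Delta> > 0"
  shows "1 / user_distance d yp xk yk t
    \<le> (1 / \<Delta> + 2 / d) * (1 / (\<bar>real_of_int \<lfloor>(t - xk) / \<Delta>\<rfloor>\<bar> + 1))"
proof -
  let ?D = "user_distance d yp xk yk t" and ?k = "\<lfloor>(t - xk) / \<Delta>\<rfloor>"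
  have dD: "d \<le> ?D"
    using assms unfolding user_distance_def by (intro real_le_rsqrt) simp
  have "\<bar>t - xk\<bar> \<le> ?D"
    unfolding user_distance_def by (intro real_le_rsqrt) (simp add: power2_commute)
  then have "\<bar>(t - xk) / \<Delta>\<bar> \<le> ?D / \<Delta>"
    using assms by (simp add: abs_divide divide_right_mono)
  \<comment> \<open>For a negative quotient the floor can move away from 0, by less than 1. With the
    \<open>+ 1\<close> of the denominator this makes the constant 2 absorbed next.\<close>
  moreover have "\<bar>real_of_int ?k\<bar> \<le> \<bar>(t - xk) / \<Delta>\<bar> + 1"
    by linarith
  moreover have "2 \<le> 2 * ?D / d"
    using dD assms by (simp add: field_simps)
  ultimately have "\<bar>real_of_int ?k\<bar> + 1 \<le> ?D / \<Delta> + 2 * ?D / d"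
    by linarith
  also have "\<dots> = (1 / \<Delta> + 2 / d) * ?D"
    by (simp add: algebra_simps)
  finally have "\<bar>real_of_int ?k\<bar> + 1 \<le> (1 / \<Delta> + 2 / d) * ?D" .
  then show ?thesis
    using dD assms by (simp add: divide_simps mult.commute)
qed

text \<open>Of order ln N / sqrt N, and free of the placement and the user position, so one bound
  serves both users.\<close>

definition channel_bound :: "real \<Rightarrow> real \<Rightarrow> real \<Rightarrow> nat \<Rightarrow> real" where
  "channel_bound \<eta> d \<Delta> N = sqrt \<eta> * (1 / \<Delta> + 2 / d) * (2 * harm N + 1) / sqrt (real N)"

lemma cmod_effective_channel_le:
  assumes "\<eta> > 0" and "d > 0" and "\<Delta> > 0" and "q \<in> feasible_set \<Delta> N"
  shows "cmod (effective_channel \<eta> d k0 lambda_g yp q0 xk yk N q) \<le> channel_bound \<eta> d \<Delta> N"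
proof -
  let ?k = "\<lambda>n. \<lfloor>(q n - xk) / \<Delta>\<rfloor>" and ?C = "1 / \<Delta> + 2 / d"
  let ?t = "\<lambda>n. complex_of_real (sqrt \<eta>) *
        exp (- \<i> * complex_of_real (k0 * user_distance d yp xk yk (q n))) /
        complex_of_real (user_distance d yp xk yk (q n)) *
        exp (- \<i> * complex_of_real (2 * pi * \<bar>q n - q0\<bar> / lambda_g))"
  have pos: "0 \<le> user_distance d yp xk yk s" for s
    unfolding user_distance_def by simp
  have inj: "inj_on ?k {1..N}"
    by (rule inj_on_bucket[OF assms(3,4)])
  have "cmod (?t n) \<le> sqrt \<eta> * ?C * (1 / (\<bar>real_of_int (?k n)\<bar> + 1))" for n
  proof -
    \<comment> \<open>Both exponentials have modulus 1, so any phase alignment is covered.\<close>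
    have "cmod (?t n) = sqrt \<eta> * (1 / user_distance d yp xk yk (q n))"
      using pos assms(1) by (simp add: norm_mult norm_divide norm_exp_eq_Re)
    also have "\<dots> \<le> sqrt \<eta> * (?C * (1 / (\<bar>real_of_int (?k n)\<bar> + 1)))"
      using assms by (intro mult_left_mono inverse_user_distance_le) auto
    finally show ?thesis by (simp only: mult.assoc)
  qed
  then have "cmod (sum ?t {1..N}) \<le> (\<Sum>n=1..N. sqrt \<eta> * ?C * (1 / (\<bar>real_of_int (?k n)\<bar> + 1)))"
    by (intro sum_norm_le)
  also have "\<dots> = sqrt \<eta> * ?C * (\<Sum>n=1..N. 1 / (\<bar>real_of_int (?k n)\<bar> + 1))"
    by (simp only: sum_distrib_left)
  \<comment> \<open>Injectivity turns the sum over antennas into one over \<open>N\<close> distinct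
    integers.\<close>
  also have "(\<Sum>n=1..N. 1 / (\<bar>real_of_int (?k n)\<bar> + 1))
      = (\<Sum>k\<in>?k ` {1..N}. 1 / (\<bar>real_of_int k\<bar> + 1))"
    by (simp only: sum.reindex[OF inj] comp_def)
  also have "sqrt \<eta> * ?C * \<dots> \<le> sqrt \<eta> * ?C * (2 * harm N + 1)"
    using assms card_image[OF inj] by (intro mult_left_mono sum_inverse_int_set_le) auto
  finally show ?thesis
    unfolding effective_channel_def channel_bound_def norm_mult
    by (simp add: norm_divide divide_right_mono)
qed

lemma channel_bound_tendsto_0: "channel_bound \<eta> d \<Delta> \<longlonglongrightarrow> 0"
proof -
  let ?g = "\<lambda>N. (2 * harm N + 1) / sqrt (real N)"
  have "?g \<longlonglongrightarrow> 0"
  proof (rule tendsto_sandwich[OF _ _ tendsto_const])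
    show "(\<lambda>N. (2 * ln (real N) + 3) / sqrt (real N)) \<longlonglongrightarrow> 0"
      by real_asymp
    show "\<forall>\<^sub>F N in sequentially. ?g N \<le> (2 * ln (real N) + 3) / sqrt (real N)"
      using eventually_gt_at_top[of 0]
    proof eventually_elim
      case (elim N)
      \<comment> \<open>harm N - ln N is decreasing from its value 1 at N = 1; doubling and adding 1
        gives the 3 above.\<close>
      then have "harm N \<le> ln (real N) + 1"
        using euler_mascheroni_sequence_decreasing[of 1 N] by (simp add: harm_def)
      then show ?case by (intro divide_right_mono) auto
    qed
  qed (auto simp: harm_nonneg)
  then have "(\<lambda>N. sqrt \<eta> * (1 / \<Delta> + 2 / d) * ?g N) \<longlonglongrightarrow> sqrt \<eta> * (1 / \<Delta> + 2 / d) * 0"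
    by (rule tendsto_mult_left)
  then show ?thesis
    unfolding channel_bound_def by simp
qed

section \<open>From channel gains to rates and regions\<close>

definition rate_bound :: "real \<Rightarrow> real \<Rightarrow> real \<Rightarrow> real" where
  "rate_bound \<sigma>2 P B = P * B\<^sup>2 / (\<sigma>2 * ln 2)"

text \<open>The noise power scales with the bandwidth share \<open>b\<close>, so after linearising
  the logarithm the factor \<open>b\<close> cancels and the bound is uniform in
  \<open>b\<close>.\<close>

lemma fdma_rate_le:
  assumes "\<sigma>2 > 0" and "P > 0" and "0 \<le> b" and "cmod h \<le> B"
  shows "fdma_rate b \<sigma>2 P h \<le> rate_bound \<sigma>2 P B"
proof (cases "b = 0")
  case True
  then show ?thesis
    using assms by (simp add: fdma_rate_def rate_bound_def)
next
  case False
  with assms have b: "b > 0" by simp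
  let ?t = "P * (cmod h)\<^sup>2 / (b * \<sigma>2)"
  have "ln (1 + ?t) \<le> ?t"
    using assms b by (intro ln_add_one_self_le_self) simp
  then have "b * log 2 (1 + ?t) \<le> b * (?t / ln 2)"
    using b unfolding log_def by (intro mult_left_mono divide_right_mono) auto
  also have "\<dots> = P * (cmod h)\<^sup>2 / (\<sigma>2 * ln 2)"
    using b by simp
  also have "\<dots> \<le> P * B\<^sup>2 / (\<sigma>2 * ln 2)"
    using assms by (intro divide_right_mono mult_left_mono power_mono) auto
  finally show ?thesis
    using b by (simp add: fdma_rate_def rate_bound_def)
qed

lemma single_user_rate_le:
  assumes "\<sigma>2 > 0" and "P > 0" and "cmod h \<le> B"
  shows "single_user_rate \<sigma>2 P h \<le> rate_bound \<sigma>2 P B"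
  \<comment> \<open>The single-user rate is the case of full bandwidth, b = 1.\<close>
  using fdma_rate_le[of \<sigma>2 P 1 h B] assms by (simp add: fdma_rate_def single_user_rate_def)

lemma regions_subset_box:
  assumes "\<Delta> > 0" and "\<sigma>2 > 0" and "P1 > 0" and "P2 > 0"
    and h1: "\<And>q. q \<in> feasible_set \<Delta> N \<Longrightarrow> cmod (h1 q) \<le> B"
    and h2: "\<And>q. q \<in> feasible_set \<Delta> N \<Longrightarrow> cmod (h2 q) \<le> B"
    and e: "rate_bound \<sigma>2 P1 B \<le> \<epsilon>" "rate_bound \<sigma>2 P2 B \<le> \<epsilon>"
  shows "tdma_region \<Delta> \<sigma>2 P1 P2 h1 h2 N \<subseteq> {0..\<epsilon>} \<times> {0..\<epsilon>}"
    and "fdma_region \<Delta> \<sigma>2 P1 P2 h1 h2 N \<subseteq> {0..\<epsilon>} \<times> {0..\<epsilon>}"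
    and "capacity_region \<Delta> \<sigma>2 P1 P2 h1 h2 N \<subseteq> {0..\<epsilon>} \<times> {0..\<epsilon>}"
proof -
  have conv: "convex ({0..\<epsilon>} \<times> {0..\<epsilon>})"
    by (intro convex_Times convex_real_interval)
  have s: "single_user_rate \<sigma>2 P1 (h1 q) \<le> \<epsilon>" "single_user_rate \<sigma>2 P2 (h2 q) \<le> \<epsilon>"
    if "q \<in> feasible_set \<Delta> N" for q
    using single_user_rate_le[OF assms(2,3) h1[OF that]]
      single_user_rate_le[OF assms(2,4) h2[OF that]] e by linarith+
  have f: "fdma_rate b \<sigma>2 P1 (h1 q) \<le> \<epsilon>" "fdma_rate b \<sigma>2 P2 (h2 q) \<le> \<epsilon>"
    if "q \<in> feasible_set \<Delta> N" "0 \<le> b" for q b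
    using fdma_rate_le[OF assms(2,3) that(2) h1[OF that(1)]]
      fdma_rate_le[OF assms(2,4) that(2) h2[OF that(1)]] e by linarith+
  have m: "max_rate \<Delta> \<sigma>2 P1 h1 N \<le> \<epsilon>" "max_rate \<Delta> \<sigma>2 P2 h2 N \<le> \<epsilon>"
    unfolding max_rate_def by (intro cSUP_least feasible_set_nonempty assms(1) s; assumption)+
  \<comment> \<open>Nonnegativity of \<epsilon> comes from that of \<open>rate_bound\<close>; it
    lets time shares in [0, 1] preserve the bound \<epsilon>.\<close>
  have "0 \<le> \<epsilon>"
    using e(1) assms(2,3) by (auto simp: rate_bound_def intro: order.trans[rotated])
  then have scale: "a * r \<le> \<epsilon>" if "0 \<le> a" "a \<le> 1" "r \<le> \<epsilon>" for a r
    using mult_left_mono[OF that(3,1)] mult_right_mono[OF that(2), of \<epsilon>] by linarith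
  show "tdma_region \<Delta> \<sigma>2 P1 P2 h1 h2 N \<subseteq> {0..\<epsilon>} \<times> {0..\<epsilon>}"
  proof (clarsimp simp: tdma_region_def)
    fix R1 R2 \<rho> :: real
    assume "R1 \<le> \<rho> * max_rate \<Delta> \<sigma>2 P1 h1 N" "R2 \<le> (1 - \<rho>) * max_rate \<Delta> \<sigma>2 P2 h2 N"
      "0 \<le> \<rho>" "\<rho> \<le> 1"
    then show "R1 \<le> \<epsilon> \<and> R2 \<le> \<epsilon>"
      using scale[OF _ _ m(1), of \<rho>] scale[OF _ _ m(2), of "1 - \<rho>"] by linarith
  qed
  show "fdma_region \<Delta> \<sigma>2 P1 P2 h1 h2 N \<subseteq> {0..\<epsilon>} \<times> {0..\<epsilon>}"
    unfolding fdma_region_def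
  proof (rule hull_minimal[of _ _ convex, OF _ conv], clarsimp)
    fix R1 R2 \<rho> q
    assume q: "q \<in> feasible_set \<Delta> N" and "0 \<le> \<rho>" "\<rho> \<le> 1"
      "R1 \<le> fdma_rate \<rho> \<sigma>2 P1 (h1 q)" "R2 \<le> fdma_rate (1 - \<rho>) \<sigma>2 P2 (h2 q)"
    then show "R1 \<le> \<epsilon> \<and> R2 \<le> \<epsilon>"
      using f(1)[OF q, of \<rho>] f(2)[OF q, of "1 - \<rho>"] by linarith
  qed
  show "capacity_region \<Delta> \<sigma>2 P1 P2 h1 h2 N \<subseteq> {0..\<epsilon>} \<times> {0..\<epsilon>}"
    unfolding capacity_region_def
    by (rule hull_minimal[of _ _ convex, OF _ conv])
       (auto simp: mac_region_def intro: order.trans[OF _ s(1)] order.trans[OF _ s(2)])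
qed

theorem mainTheorem6:
  fixes \<eta> \<sigma>2 d k0 lambda_g \<Delta> P1 P2 yp q0 x1 y1 x2 y2 :: real
  assumes "\<eta> > 0" and "\<sigma>2 > 0" and "d > 0" and "k0 > 0" and "lambda_g > 0" and "\<Delta> > 0"
    and "P1 > 0" and "P2 > 0"
  shows "let h1 = effective_channel \<eta> d k0 lambda_g yp q0 x1 y1;
             h2 = effective_channel \<eta> d k0 lambda_g yp q0 x2 y2
         in regions_tend_to_origin (\<lambda>N. tdma_region \<Delta> \<sigma>2 P1 P2 (h1 N) (h2 N) N) \<and>
            regions_tend_to_origin (\<lambda>N. fdma_region \<Delta> \<sigma>2 P1 P2 (h1 N) (h2 N) N) \<and>
            regions_tend_to_origin (\<lambda>N. capacity_region \<Delta> \<sigma>2 P1 P2 (h1 N) (h2 N) N)"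
proof -
  define h1 where "h1 = effective_channel \<eta> d k0 lambda_g yp q0 x1 y1"
  define h2 where "h2 = effective_channel \<eta> d k0 lambda_g yp q0 x2 y2"
  let ?B = "channel_bound \<eta> d \<Delta>"
  have lim: "(\<lambda>N. rate_bound \<sigma>2 P (?B N)) \<longlonglongrightarrow> 0" for P
  proof -
    have "(\<lambda>N. P * (?B N)\<^sup>2 / (\<sigma>2 * ln 2)) \<longlonglongrightarrow> P * 0\<^sup>2 / (\<sigma>2 * ln 2)"
      using assms(2) by (intro tendsto_intros channel_bound_tendsto_0) simp
    then show ?thesis by (simp add: rate_bound_def)
  qed
  have "\<exists>N0. \<forall>N\<ge>N0. tdma_region \<Delta> \<sigma>2 P1 P2 (h1 N) (h2 N) N \<subseteq> {0..\<epsilon>} \<times> {0..\<epsilon>} \<and>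
      fdma_region \<Delta> \<sigma>2 P1 P2 (h1 N) (h2 N) N \<subseteq> {0..\<epsilon>} \<times> {0..\<epsilon>} \<and>
      capacity_region \<Delta> \<sigma>2 P1 P2 (h1 N) (h2 N) N \<subseteq> {0..\<epsilon>} \<times> {0..\<epsilon>}"
    if "\<epsilon> > 0" for \<epsilon>
  proof -
    \<comment> \<open>One threshold for both powers serves all three regions.\<close>
    have "\<forall>\<^sub>F N in sequentially. rate_bound \<sigma>2 P1 (?B N) < \<epsilon> \<and> rate_bound \<sigma>2 P2 (?B N) < \<epsilon>"
      using order_tendstoD(2)[OF lim that] by (intro eventually_conj)
    then obtain N0 where N0: "\<And>N. N \<ge> N0 \<Longrightarrow>
        rate_bound \<sigma>2 P1 (?B N) \<le> \<epsilon> \<and> rate_bound \<sigma>2 P2 (?B N) \<le> \<epsilon>"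
      unfolding eventually_sequentially using less_imp_le by blast
    show ?thesis
    proof (intro exI[of _ N0] allI impI conjI)
      fix N assume "N \<ge> N0"
      \<comment> \<open>The two premises skipped by \<open>_\<close> say only that a feasible
        placement is feasible; \<open>assumption\<close> closes them.\<close>
      note box = regions_subset_box[OF assms(6,2,7,8),
          OF cmod_effective_channel_le[OF assms(1,3,6)] cmod_effective_channel_le[OF assms(1,3,6)],
          OF _ _ N0[OF this, THEN conjunct1] N0[OF this, THEN conjunct2]]
      show "tdma_region \<Delta> \<sigma>2 P1 P2 (h1 N) (h2 N) N \<subseteq> {0..\<epsilon>} \<times> {0..\<epsilon>}"
        "fdma_region \<Delta> \<sigma>2 P1 P2 (h1 N) (h2 N) N \<subseteq> {0..\<epsilon>} \<times> {0..\<epsilon>}"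
        "capacity_region \<Delta> \<sigma>2 P1 P2 (h1 N) (h2 N) N \<subseteq> {0..\<epsilon>} \<times> {0..\<epsilon>}"
        unfolding h1_def h2_def by (rule box; assumption)+
    qed
  qed
  then show ?thesis
    unfolding Let_def regions_tend_to_origin_def h1_def h2_def by meson
qed

end
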